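(* Let $q$ be a power of a prime and let $k\ge 2$ be an integer. Then the Grassmann graph $J_q(2k+1,2)$ is a core.
   Context: $\mathbb{F}_q$ denotes the finite field with $q$ elements. The Grassmann graph $J_q(n,m)$ is the simple undirected graph whose vertices are the $m$-dimensional subspaces of an $n$-dimensional vector space over $\mathbb{F}_q$, two vertices $X,Y$ being adjacent iff $\dim(X\cap Y)=m-1$. An endomorphism of a graph $G$ is a map $\varphi:V(G)\to V(G)$ such that $\varphi(x)\sim\varphi(y)$ whenever $x\sim y$. A graph is a core if every endomorphism of it is an automorphism. *)

theory Defs
  imports "HOL-Number_Theory.Prime_Powers" "Graph_Theory.Pair_Digraph"
begin

text \<open>
  A simple undirected graph is a loop-free pair digraph whose arc relation is symmetric
  (the locale \<^locale>\<open>pair_bidirected_digraph\<close>), so that adjacency of \<open>x\<close> and \<open>y\<close> is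
  \<open>x \<rightarrow>\<^bsub>G\<^esub> y\<close>. Vertex maps are total HOL functions of which only the restriction to the
  vertex set matters.
\<close>

definition graph_endomorphism :: "'v pair_pre_digraph \<Rightarrow> ('v \<Rightarrow> 'v) \<Rightarrow> bool" where
  "graph_endomorphism G \<phi> \<longleftrightarrow>
     \<phi> \<in> pverts G \<rightarrow> pverts G \<and>
     (\<forall>x\<in>pverts G. \<forall>y\<in>pverts G. x \<rightarrow>\<^bsub>G\<^esub> y \<longrightarrow> \<phi> x \<rightarrow>\<^bsub>G\<^esub> \<phi> y)"

definition graph_automorphism :: "'v pair_pre_digraph \<Rightarrow> ('v \<Rightarrow> 'v) \<Rightarrow> bool" where
  "graph_automorphism G \<phi> \<longleftrightarrow>
     bij_betw \<phi> (pverts G) (pverts G) \<and>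
     (\<forall>x\<in>pverts G. \<forall>y\<in>pverts G. x \<rightarrow>\<^bsub>G\<^esub> y \<longleftrightarrow> \<phi> x \<rightarrow>\<^bsub>G\<^esub> \<phi> y)"

definition is_core :: "'v pair_pre_digraph \<Rightarrow> bool" where
  "is_core G \<longleftrightarrow> (\<forall>\<phi>. graph_endomorphism G \<phi> \<longrightarrow> graph_automorphism G \<phi>)"

text \<open>
  The ambient vector space is the whole type \<open>'b\<close> with scalar multiplication \<open>scale\<close>; the
  parameters \<open>q\<close> and \<open>n\<close> of \<open>J\<^sub>q(n,m)\<close> are the cardinality of \<open>'a\<close> and the dimension of
  \<open>'b\<close>. The adjacency condition \<open>dim (X \<inter> Y) = m - 1\<close> is written without truncated
  subtraction, which would create a loop for \<open>m = 0\<close>.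
\<close>

definition grassmann_graph ::
  "('a::field \<Rightarrow> 'b::ab_group_add \<Rightarrow> 'b) \<Rightarrow> nat \<Rightarrow> 'b set pair_pre_digraph" where
  "grassmann_graph scale m =
     (let V = {X. module.subspace scale X \<and> vector_space.dim scale X = m}
      in \<lparr> pverts = V,
           parcs = {(X, Y). X \<in> V \<and> Y \<in> V \<and> vector_space.dim scale (X \<inter> Y) + 1 = m} \<rparr>)"

lemma pair_bidirected_digraph_grassmann_graph:
  "pair_bidirected_digraph (grassmann_graph scale m)"
proof unfold_locales
  fix e assume e: "e \<in> parcs (grassmann_graph scale m)"
  show "fst e \<in> pverts (grassmann_graph scale m)"
    using e unfolding grassmann_graph_def Let_def by (cases e) simp
  show "snd e \<in> pverts (grassmann_graph scale m)"
    using e unfolding grassmann_graph_def Let_def by (cases e) simp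
  show "fst e \<noteq> snd e"
    using e unfolding grassmann_graph_def Let_def by (cases e) auto
next
  have "sym (parcs (grassmann_graph scale m))"
    by (rule symI, simp add: grassmann_graph_def Let_def, metis Int_commute)
  then show "symmetric (with_proj (grassmann_graph scale m))"
    unfolding symmetric_def with_proj_simps .
qed

end

theory Submission
  imports Defs
begin

text \<open>
  Read \<open>J\<^sub>q(n,2)\<close> as the graph of intersecting lines of a projective space. A clique of lines lies
  in the star of a point or in a plane, and stars have more lines than planes, so an endomorphism
  sends stars bijectively onto stars and thereby induces a map \<open>f\<close> on points. Counting lines shows
  that \<open>f\<close> is injective or constant on each plane. If \<open>f\<close> identifies two points, it is therefore
  constant, all lines are mapped into a single star, and each fibre is a line spread. For odd \<open>n\<close>
  no spread exists, since \<open>q\<^sup>2 - 1\<close> does not divide \<open>q\<^sup>n - 1\<close>. So \<open>f\<close> is injective, hence so is the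
  endomorphism, and finiteness makes it an automorphism.
\<close>

section \<open>Counting vectors in subspaces over a finite field\<close>

locale finite_vector_space = finite_dimensional_vector_space scale Basis
  for scale :: "'a::field \<Rightarrow> 'b::ab_group_add \<Rightarrow> 'b" (infixr "*s" 75) and Basis +
  fixes q :: nat
  assumes finite_scalars: "finite (UNIV :: 'a set)"
    and card_scalars: "card (UNIV :: 'a set) = q"
begin

lemma q_ge_2: "q \<ge> 2"
proof -
  have "card {0, 1 :: 'a} \<le> q"
    unfolding card_scalars[symmetric]
    by (rule card_mono[OF finite_scalars]) simp
  then show ?thesis by simp
qed

text \<open>Each new basis vector \<open>b\<close> multiplies the size by \<open>q\<close>: a vector
  of the larger span is uniquely \<open>c *s b + x\<close> with \<open>x\<close> in the old
  span.\<close>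

lemma card_span_independent:
  assumes "finite B" "independent B"
  shows "finite (span B) \<and> card (span B) = q ^ card B"
  using assms
proof (induction B rule: finite_induct)
  case empty
  then show ?case by simp
next
  case (insert b B)
  have indep: "independent B" and b: "b \<notin> span B"
    using insert by (auto simp: independent_insert)
  let ?h = "\<lambda>(c, x). c *s b + x"
  have eq: "span (insert b B) = ?h ` (UNIV \<times> span B)"
  proof (intro set_eqI iffI)
    fix x assume "x \<in> span (insert b B)"
    then obtain c where "x - c *s b \<in> span B"
      by (auto simp: span_breakdown_eq)
    then have "x = ?h (c, x - c *s b)" "(c, x - c *s b) \<in> UNIV \<times> span B"
      by auto
    then show "x \<in> ?h ` (UNIV \<times> span B)" by blast
  next
    fix x assume "x \<in> ?h ` (UNIV \<times> span B)"
    then obtain c y where "x = c *s b + y" "y \<in> span B" by auto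
    then have "x - c *s b \<in> span B" by simp
    then show "x \<in> span (insert b B)" by (auto simp: span_breakdown_eq)
  qed
  have "inj_on ?h (UNIV \<times> span B)"
  proof (rule inj_onI, clarify)
    fix c x d y assume x: "x \<in> span B" and y: "y \<in> span B" and e: "c *s b + x = d *s b + y"
    have "(c - d) *s b = y - x"
      using e by (simp add: scale_left_diff_distrib algebra_simps)
    then have m: "(c - d) *s b \<in> span B"
      using x y by (simp add: span_diff)
    have "c = d"
    proof (rule ccontr)
      assume "c \<noteq> d"
      then have "b = inverse (c - d) *s ((c - d) *s b)" by simp
      then show False using span_scale[OF m, of "inverse (c - d)"] b by simp
    qed
    then show "c = d \<and> x = y" using e by simp
  qed
  then show ?case
    using insert indep finite_scalars unfolding eq
    by (simp add: card_image card_cartesian_product card_scalars)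
qed

lemma card_subspace:
  assumes "subspace U"
  shows "finite U" "card U = q ^ dim U"
proof -
  obtain B where B: "B \<subseteq> U" "independent B" "U \<subseteq> span B" "card B = dim U"
    using basis_exists by metis
  have "span B = U" using B assms by (meson span_minimal subset_antisym)
  then show "finite U" "card U = q ^ dim U"
    using card_span_independent[of B] B finiteI_independent by auto
qed

lemma finite_UNIV: "finite (UNIV :: 'b set)"
  by (rule card_subspace) (rule subspace_UNIV)

lemma finite_vectors [simp]: "finite (A :: 'b set)"
  by (rule finite_subset[OF subset_UNIV finite_UNIV])

lemma card_span_singleton: "v \<noteq> 0 \<Longrightarrow> card (span {v}) = q"
  using card_subspace(2)[OF subspace_span, of "{v}"] by simp

lemma span_singleton_eq:
  assumes "u \<in> span {v}" "u \<noteq> 0"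
  shows "span {u} = span {v}"
proof -
  have "v \<in> span {u}" using in_span_insert[of u v "{}"] assms by simp
  then show ?thesis using assms(1) by (simp add: span_eq)
qed

lemma dim_span_insert: "u \<notin> span S \<Longrightarrow> dim (span (insert u S)) = dim S + 1"
  by (simp add: dim_insert)

section \<open>Projective lines and their incidence\<close>

definition is_line :: "'b set \<Rightarrow> bool" where
  "is_line X \<longleftrightarrow> subspace X \<and> dim X = 2"

definition adjacent :: "'b set \<Rightarrow> 'b set \<Rightarrow> bool" where
  "adjacent X Y \<longleftrightarrow> is_line X \<and> is_line Y \<and> dim (X \<inter> Y) = 1"

text \<open>The bound \<open>U\<close> lets one notion serve both the full star of a point
  (\<open>U = UNIV\<close>) and the pencil of a point in a plane.\<close>

definition star :: "'b \<Rightarrow> 'b set \<Rightarrow> 'b set set" where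
  "star v U = {X. is_line X \<and> v \<in> X \<and> X \<subseteq> U}"

definition lines_in :: "'b set \<Rightarrow> 'b set set" where
  "lines_in U = {X. is_line X \<and> X \<subseteq> U}"

lemma is_line_span: "v \<noteq> 0 \<Longrightarrow> u \<notin> span {v} \<Longrightarrow> is_line (span {u, v})"
  by (simp add: is_line_def dim_insert)

lemma line_eq_span:
  assumes "is_line X" "u \<in> X" "v \<in> X" "v \<noteq> 0" "u \<notin> span {v}"
  shows "X = span {u, v}"
proof -
  have "span {u, v} \<subseteq> X"
    using assms by (intro span_minimal) (auto simp: is_line_def)
  then show ?thesis
    using subspace_dim_equal[of "span {u, v}" X] is_line_span[OF assms(4,5)] assms(1)
    by (auto simp: is_line_def)
qed

lemma line_subset:
  assumes "is_line X" "subspace U" "u \<in> X \<inter> U" "v \<in> X \<inter> U" "v \<noteq> 0" "u \<notin> span {v}"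
  shows "X \<subseteq> U"
  using line_eq_span[of X u v] span_minimal[of "{u, v}" U] assms by simp

lemma line_span_singleton_subset: "is_line X \<Longrightarrow> v \<in> X \<Longrightarrow> span {v} \<subseteq> X"
  by (simp add: is_line_def span_minimal)

lemma line_has_nonzero: "is_line X \<Longrightarrow> \<exists>v\<in>X. v \<noteq> 0"
  using dim_eq_0[of X] by (fastforce simp: is_line_def simp del: dim_eq_0)

text \<open>Two independent common vectors would span both lines and make them equal.\<close>

lemma lines_meet_in_point:
  assumes "is_line X" "is_line Y" "X \<noteq> Y" "u \<in> X \<inter> Y" "v \<in> X \<inter> Y" "v \<noteq> 0"
  shows "u \<in> span {v}"
  using line_eq_span[of X u v] line_eq_span[of Y u v] assms by blast

text \<open>Replaces the dimension condition by incidence: distinct lines share at most a point, so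
  one common nonzero vector already gives dimension 1.\<close>

lemma adjacent_iff:
  "adjacent X Y \<longleftrightarrow> is_line X \<and> is_line Y \<and> X \<noteq> Y \<and> (\<exists>v\<noteq>0. v \<in> X \<inter> Y)" (is "?l \<longleftrightarrow> ?r")
proof
  assume l: ?l
  then have "X \<noteq> Y" by (auto simp: adjacent_def is_line_def)
  moreover have "\<not> X \<inter> Y \<subseteq> {0}"
  proof
    assume "X \<inter> Y \<subseteq> {0}"
    then have "dim (X \<inter> Y) = 0" by simp
    then show False using l unfolding adjacent_def by linarith
  qed
  ultimately show ?r using l by (auto simp: adjacent_def)
next
  assume r: ?r
  then obtain v where v: "v \<noteq> 0" "v \<in> X \<inter> Y" by blast
  have "X \<inter> Y = span {v}"
    using lines_meet_in_point[of X Y _ v] line_span_singleton_subset[of _ v] r v by blast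
  then show ?l using r v by (simp add: adjacent_def)
qed

lemma finite_lines [simp]: "finite (L :: 'b set set)"
  by (rule finite_subset[of _ UNIV]) (auto simp: Finite_Set.finite_set finite_UNIV)

section \<open>Counting lines through a point and lines in a plane\<close>

text \<open>The lines through \<open>v\<close> partition \<open>U - span {v}\<close> into pieces of
  size \<open>q ^ 2 - q\<close>. The product form avoids division of naturals.\<close>

lemma card_star_mult:
  assumes U: "subspace U" and v: "v \<in> U" "v \<noteq> 0"
  shows "card (star v U) * (q ^ 2 - q) = q ^ dim U - q"
proof -
  have sub: "span {v} \<subseteq> U" using U v by (simp add: span_minimal)
  have eq: "U - span {v} = (\<Union>X\<in>star v U. X - span {v})"
  proof (intro set_eqI iffI)
    fix u assume u: "u \<in> U - span {v}"
    have "span {u, v} \<in> star v U"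
      using is_line_span[of v u] span_minimal[of "{u, v}" U] u v U by (simp add: star_def span_base)
    moreover have "u \<in> span {u, v}" by (simp add: span_base)
    ultimately show "u \<in> (\<Union>X\<in>star v U. X - span {v})" using u by blast
  qed (auto simp: star_def)
  have "card (\<Union>X\<in>star v U. X - span {v}) = (\<Sum>X\<in>star v U. card (X - span {v}))"
  proof (rule card_UN_disjoint)
    show "\<forall>X\<in>star v U. \<forall>Y\<in>star v U. X \<noteq> Y \<longrightarrow> (X - span {v}) \<inter> (Y - span {v}) = {}"
      using lines_meet_in_point[of _ _ _ v] v by (auto simp: star_def)
  qed simp_all
  also have "\<dots> = (\<Sum>X\<in>star v U. q ^ 2 - q)"
  proof (rule sum.cong[OF refl])
    fix X assume "X \<in> star v U"
    then show "card (X - span {v}) = q ^ 2 - q"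
      using line_span_singleton_subset[of X v] card_subspace[of X] card_span_singleton[OF v(2)]
      by (simp add: card_Diff_subset star_def is_line_def)
  qed
  finally show ?thesis
    unfolding eq[symmetric] using sub card_subspace[OF U] card_span_singleton[OF v(2)]
    by (simp add: card_Diff_subset)
qed

lemma card_star_plane:
  assumes U: "subspace U" "dim U = 3" and v: "v \<in> U" "v \<noteq> 0"
  shows "card (star v U) = q + 1"
proof -
  have "card (star v U) * (q ^ 2 - q) = (q + 1) * (q ^ 2 - q)"
    using card_star_mult[OF U(1) v] U(2)
    by (simp add: algebra_simps power2_eq_square power3_eq_cube diff_mult_distrib2)
  moreover have "q ^ 2 - q \<noteq> 0" using q_ge_2 by (simp add: power2_eq_square)
  ultimately show ?thesis using mult_right_cancel by blast
qed

text \<open>Double counting of incidences between nonzero vectors and lines: each vector lies on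
  \<open>q + 1\<close> lines, each line has \<open>q ^ 2 - 1\<close> nonzero vectors.\<close>

lemma card_lines_in_plane:
  assumes U: "subspace U" "dim U = 3"
  shows "card (lines_in U) = q ^ 2 + q + 1"
proof -
  have card_nz: "card (X - {0}) = q ^ dim X - 1" if "subspace X" for X
    using card_subspace[OF that] subspace_0[OF that] by (simp add: card_Diff_subset)
  have "(\<Sum>X\<in>lines_in U. card {v \<in> U - {0}. v \<in> X}) = (q + 1) * card (U - {0})"
  proof (rule sum_multicount)
    show "\<forall>v\<in>U - {0}. card {X \<in> lines_in U. v \<in> X} = q + 1"
    proof
      fix v assume "v \<in> U - {0}"
      moreover have "{X \<in> lines_in U. v \<in> X} = star v U" by (auto simp: lines_in_def star_def)
      ultimately show "card {X \<in> lines_in U. v \<in> X} = q + 1"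
        using card_star_plane[OF U] by simp
    qed
  qed simp_all
  moreover have "card {v \<in> U - {0}. v \<in> X} = q ^ 2 - 1" if "X \<in> lines_in U" for X
  proof -
    have "{v \<in> U - {0}. v \<in> X} = X - {0}" using that by (auto simp: lines_in_def)
    then show ?thesis using card_nz[of X] that by (simp add: lines_in_def is_line_def)
  qed
  ultimately have "card (lines_in U) * (q ^ 2 - 1) = (q + 1) * (q ^ 3 - 1)"
    using card_nz[OF U(1)] U(2) by simp
  also have "\<dots> = (q ^ 2 + q + 1) * (q ^ 2 - 1)"
  proof -
    \<comment> \<open>Writing \<open>q\<close> as a successor eliminates the truncated
      subtractions.\<close>
    obtain r where "q = Suc r" using q_ge_2 by (cases q) auto
    then show ?thesis by (simp add: algebra_simps power2_eq_square power3_eq_cube)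
  qed
  finally have "card (lines_in U) * (q ^ 2 - 1) = (q ^ 2 + q + 1) * (q ^ 2 - 1)" .
  moreover have "q ^ 2 - 1 \<noteq> 0" using q_ge_2 one_less_power[of q 2] by simp
  ultimately show ?thesis using mult_right_cancel by blast
qed

section \<open>Cliques of pairwise intersecting lines\<close>

definition is_clique :: "'b set set \<Rightarrow> bool" where
  "is_clique C \<longleftrightarrow> (\<forall>X\<in>C. is_line X) \<and> (\<forall>X\<in>C. \<forall>Y\<in>C. X \<noteq> Y \<longrightarrow> adjacent X Y)"

lemma is_clique_star: "v \<noteq> 0 \<Longrightarrow> is_clique (star v U)"
  unfolding is_clique_def star_def adjacent_iff by blast

text \<open>By the dimension formula, two lines meeting trivially would have a sum of dimension 4
  inside a space of dimension 3.\<close>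

lemma lines_in_plane_meet:
  assumes U: "subspace U" "dim U = 3" and "is_line X" "is_line Y" "X \<subseteq> U" "Y \<subseteq> U"
  shows "\<exists>v\<noteq>0. v \<in> X \<inter> Y"
proof (rule ccontr)
  assume "\<not> ?thesis"
  then have "X \<inter> Y \<subseteq> {0}" by blast
  then have "dim (X \<inter> Y) = 0" by simp
  then have "dim {x + y |x y. x \<in> X \<and> y \<in> Y} = 4"
    using dim_sums_Int[of X Y] assms by (simp add: is_line_def del: dim_eq_0)
  moreover have "dim {x + y |x y. x \<in> X \<and> y \<in> Y} \<le> dim U"
    using assms subspace_add[OF U(1)] by (intro dim_subset) blast
  ultimately show False using U by simp
qed

lemma is_clique_lines_in_plane:
  "subspace U \<Longrightarrow> dim U = 3 \<Longrightarrow> is_clique (lines_in U)"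
  unfolding is_clique_def adjacent_iff using lines_in_plane_meet by (auto simp: lines_in_def)

text \<open>If no point is common to all members, take members \<open>X\<close>, \<open>Y\<close>
  meeting in \<open>v\<close>; the plane is \<open>X + Y\<close>. A member avoiding \<open>v\<close>
  meets \<open>X\<close> and \<open>Y\<close> in different points, so it lies in the plane. A member
  through \<open>v\<close> meets some such \<open>Z\<close> in a second point of the plane, so it
  lies there too.\<close>

lemma clique_cases:
  assumes C: "is_clique C" "C \<noteq> {}"
  shows "(\<exists>v\<noteq>0. C \<subseteq> star v UNIV) \<or> (\<exists>U. subspace U \<and> dim U = 3 \<and> C \<subseteq> lines_in U)"
proof (cases "\<exists>v\<noteq>0. C \<subseteq> star v UNIV")
  case False
  have line: "is_line X" if "X \<in> C" for X using C that by (auto simp: is_clique_def)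
  have meet: "\<exists>v\<noteq>0. v \<in> X \<inter> Y" if "X \<in> C" "Y \<in> C" for X Y
    using C that line_has_nonzero[OF line[OF that(1)]]
    by (cases "X = Y") (auto simp: is_clique_def adjacent_iff)
  have no_center: "\<exists>X\<in>C. v \<notin> X" if "v \<noteq> 0" for v
    using False that line by (auto simp: star_def)
  obtain X where X: "X \<in> C" using C by blast
  \<comment> \<open>A point of \<open>X\<close> is missed by some member, which is then a second
    line \<open>Y\<close>.\<close>
  obtain x where "x \<in> X" "x \<noteq> 0" using line_has_nonzero[OF line[OF X]] by blast
  then obtain Y where Y: "Y \<in> C" "X \<noteq> Y" using no_center by blast
  obtain v where v: "v \<noteq> 0" "v \<in> X \<inter> Y" using meet[OF X Y(1)] by blast
  let ?U = "{x + y |x y. x \<in> X \<and> y \<in> Y}"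
  have sub: "subspace X" "subspace Y" using line X Y by (auto simp: is_line_def)
  have U: "subspace ?U" by (rule subspace_sums[OF sub])
  have "X \<subseteq> ?U"
    using subspace_0[OF sub(2)] by (smt (verit, best) add.right_neutral mem_Collect_eq subsetI)
  moreover have "Y \<subseteq> ?U"
    using subspace_0[OF sub(1)] by (smt (verit, best) add.left_neutral mem_Collect_eq subsetI)
  ultimately have XU: "X \<subseteq> ?U" and YU: "Y \<subseteq> ?U" by auto
  have "dim (X \<inter> Y) = 1" using C X Y by (auto simp: is_clique_def adjacent_def)
  then have dimU: "dim ?U = 3"
    using dim_sums_Int[OF sub] line X Y by (auto simp: is_line_def)
  have avoid: "Z \<subseteq> ?U" if Z: "Z \<in> C" "v \<notin> Z" for Z
  proof -
    obtain x y where x: "x \<noteq> 0" "x \<in> Z \<inter> X" and y: "y \<noteq> 0" "y \<in> Z \<inter> Y"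
      using meet[OF Z(1) X] meet[OF Z(1) Y(1)] by blast
    \<comment> \<open>If both meeting points coincided, they would be the point \<open>v\<close> of
      \<open>X \<inter> Y\<close>, which \<open>Z\<close> avoids.\<close>
    have "x \<notin> span {y}"
    proof
      assume "x \<in> span {y}"
      then have "x \<in> X \<inter> Y"
        using line_span_singleton_subset[of Y y] line Y x y by blast
      then have "v \<in> span {x}"
        using lines_meet_in_point[of X Y v x] line X Y v x by blast
      then show False
        using line_span_singleton_subset[of Z x] line Z x by blast
    qed
    then show ?thesis
      using line_subset[OF line[OF Z(1)] U, of x y] x y XU YU by blast
  qed
  obtain Z where Z: "Z \<in> C" "v \<notin> Z" using no_center[OF v(1)] by blast
  have "W \<subseteq> ?U" if W: "W \<in> C" for W
  proof (cases "v \<in> W")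
    case True
    obtain z where z: "z \<noteq> 0" "z \<in> W \<inter> Z" using meet[OF W Z(1)] by blast
    have "v \<notin> span {z}" using line_span_singleton_subset[of Z z] line Z z by blast
    then show ?thesis
      using line_subset[OF line[OF W] U, of v z] True v z XU avoid[OF Z] by blast
  qed (use avoid W in blast)
  then have "C \<subseteq> lines_in ?U" using line by (simp add: lines_in_def subset_iff)
  then show ?thesis using U dimU by blast
qed simp

end

section \<open>Endomorphisms and the induced map on points\<close>

text \<open>Dimension at least 5 makes stars larger than planes; odd dimension rules out line
  spreads.\<close>

locale line_graph_endomorphism = finite_vector_space +
  fixes \<phi> :: "'b set \<Rightarrow> 'b set"
  assumes dim_ge_5: "dim (UNIV :: 'b set) \<ge> 5"
    and odd_dim: "odd (dim (UNIV :: 'b set))"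
    and line_map: "is_line X \<Longrightarrow> is_line (\<phi> X)"
    and adjacent_map: "adjacent X Y \<Longrightarrow> adjacent (\<phi> X) (\<phi> Y)"
begin

abbreviation lines_through :: "'b \<Rightarrow> 'b set set" where
  "lines_through v \<equiv> star v UNIV"

text \<open>Identifying two adjacent lines would make their common image adjacent to itself.\<close>

lemma inj_on_clique:
  assumes "is_clique C"
  shows "inj_on \<phi> C"
proof (rule inj_onI, rule ccontr)
  fix X Y assume "X \<in> C" "Y \<in> C" "\<phi> X = \<phi> Y" "X \<noteq> Y"
  then have "adjacent (\<phi> X) (\<phi> X)" using assms adjacent_map[of X Y] by (auto simp: is_clique_def)
  then show False by (simp add: adjacent_iff)
qed

lemma is_clique_image: "is_clique C \<Longrightarrow> is_clique (\<phi> ` C)"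
proof -
  assume C: "is_clique C"
  have "adjacent (\<phi> X) (\<phi> Y)" if "X \<in> C" "Y \<in> C" "\<phi> X \<noteq> \<phi> Y" for X Y
  proof -
    have "X \<noteq> Y" using that(3) by blast
    then show ?thesis using C that by (intro adjacent_map) (simp add: is_clique_def)
  qed
  then show ?thesis using C line_map by (simp add: is_clique_def)
qed

text \<open>After multiplication by \<open>q ^ 2 - q\<close> the two counts become
  \<open>q ^ 4 - q\<close> and \<open>q ^ n - q\<close>, where \<open>n\<close> is at least
  5.\<close>

lemma card_plane_less_star:
  assumes "subspace U" "dim U = 3" "v \<noteq> 0"
  shows "card (lines_in U) < card (lines_through v)"
proof -
  let ?n = "dim (UNIV :: 'b set)"
  have "card (lines_in U) * (q ^ 2 - q) = q ^ 4 - q"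
    unfolding card_lines_in_plane[OF assms(1,2)]
    by (simp add: algebra_simps power2_eq_square power4_eq_xxxx diff_mult_distrib2)
  also have "\<dots> < q ^ ?n - q"
  proof (rule diff_less_mono)
    show "q ^ 4 < q ^ ?n" using q_ge_2 dim_ge_5 by (intro power_strict_increasing) auto
    show "q \<le> q ^ 4" using q_ge_2 by (intro self_le_power) auto
  qed
  also have "\<dots> = card (lines_through v) * (q ^ 2 - q)"
    using card_star_mult[OF subspace_UNIV _ assms(3)] by simp
  finally show ?thesis by simp
qed

lemma card_star_eq:
  assumes "u \<noteq> 0" "v \<noteq> 0"
  shows "card (lines_through u) = card (lines_through v)"
proof -
  have "card (lines_through u) * (q ^ 2 - q) = card (lines_through v) * (q ^ 2 - q)"
    using assms card_star_mult[OF subspace_UNIV] by simp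
  moreover have "q ^ 2 - q > 0" using q_ge_2 by (simp add: power2_eq_square)
  ultimately show ?thesis by simp
qed

text \<open>The image is a clique as large as a star, hence too large for a plane. It therefore lies
  in a star, and equal cardinalities give equality.\<close>

lemma star_image:
  assumes v: "v \<noteq> 0"
  shows "\<exists>w\<noteq>0. \<phi> ` lines_through v = lines_through w"
proof -
  let ?C = "\<phi> ` lines_through v"
  have card: "card ?C = card (lines_through v)"
    using card_image[OF inj_on_clique[OF is_clique_star[OF v]]] .
  have small: False if "subspace U" "dim U = 3" "?C \<subseteq> lines_in U" for U
    using card_mono[OF _ that(3)] card card_plane_less_star[OF that(1,2) v] by simp
  have "lines_through v \<noteq> {}"
  proof
    assume "lines_through v = {}"
    then have "q ^ dim (UNIV :: 'b set) - q = 0"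
      using card_star_mult[OF subspace_UNIV _ v] by simp
    moreover have "q ^ 1 < q ^ dim (UNIV :: 'b set)"
      using q_ge_2 dim_ge_5 by (intro power_strict_increasing) auto
    ultimately show False by simp
  qed
  then obtain w where w: "w \<noteq> 0" "?C \<subseteq> lines_through w"
    using clique_cases[OF is_clique_image[OF is_clique_star[OF v]]] small by blast
  then have "?C = lines_through w"
    using card card_star_eq[OF v w(1)] by (intro card_subset_eq) auto
  then show ?thesis using w by blast
qed

text \<open>Points are represented by nonzero vectors; equality of points is equality of spans.\<close>

definition f :: "'b \<Rightarrow> 'b" where
  "f v = (SOME w. w \<noteq> 0 \<and> \<phi> ` lines_through v = lines_through w)"

lemma f:
  assumes "v \<noteq> 0"
  shows "f v \<noteq> 0" "\<phi> ` lines_through v = lines_through (f v)"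
proof -
  have "f v \<noteq> 0 \<and> \<phi> ` lines_through v = lines_through (f v)"
    unfolding f_def by (rule someI_ex[OF star_image[OF assms]])
  then show "f v \<noteq> 0" "\<phi> ` lines_through v = lines_through (f v)" by simp_all
qed

lemma f_mem:
  assumes "is_line X" "v \<in> X" "v \<noteq> 0"
  shows "f v \<in> \<phi> X"
proof -
  have "\<phi> X \<in> lines_through (f v)" using f(2)[OF assms(3)] assms by (auto simp: star_def)
  then show ?thesis by (simp add: star_def)
qed

section \<open>Collapsing: one identified pair of points makes the point map constant\<close>

lemma second_line:
  assumes "subspace U" "dim U = 3" "v \<in> U" "v \<noteq> 0"
  shows "\<exists>Y\<in>star v U. Y \<noteq> X"
proof (rule ccontr)
  assume "\<not> ?thesis"
  then have "star v U \<subseteq> {X}" by blast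
  then have "card (star v U) \<le> 1" using card_mono[of "{X}" "star v U"] by simp
  then show False using card_star_plane[OF assms] q_ge_2 by simp
qed

text \<open>The image of the lines of \<open>U\<close> is a clique. If it lies in the star of
  \<open>x\<close>, every point of \<open>U\<close> goes to \<open>x\<close>. If it lies in a plane,
  \<open>\<phi>\<close> already maps the pencil of \<open>v\<close> onto the whole pencil of
  \<open>f v\<close>, leaving no room for the image of a line through \<open>u\<close> that misses
  \<open>v\<close>: a contradiction.\<close>

lemma collapse_plane:
  assumes U: "subspace U" "dim U = 3" and u: "u \<in> U" "u \<notin> span {v}" and v: "v \<in> U" "v \<noteq> 0"
    and fuv: "f u \<in> span {f v}" and w: "w \<in> U" "w \<noteq> 0"
  shows "f w \<in> span {f v}"
proof -
  have cl: "is_clique (lines_in U)" using U by (rule is_clique_lines_in_plane)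
  have inj: "inj_on \<phi> (lines_in U)" using cl by (rule inj_on_clique)
  have ne: "lines_in U \<noteq> {}" using card_lines_in_plane[OF U] by force
  have u0: "u \<noteq> 0" using u(2) span_zero by auto
  have star_sub: "star x U \<subseteq> lines_in U" for x by (auto simp: star_def lines_in_def)
  from clique_cases[OF is_clique_image[OF cl]] ne
  consider (center) x where "x \<noteq> 0" "\<phi> ` lines_in U \<subseteq> lines_through x"
    | (plane) U' where "subspace U'" "dim U' = 3" "\<phi> ` lines_in U \<subseteq> lines_in U'"
    by blast
  then show ?thesis
  proof cases
    case center
    \<comment> \<open>Two lines through \<open>y\<close> have distinct images, both containing
      \<open>f y\<close> and \<open>x\<close>, so these are the same point.\<close>
    have fx: "f y \<in> span {x}" if y: "y \<in> U" "y \<noteq> 0" for y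
    proof -
      obtain X where X: "X \<in> star y U" using second_line[OF U y] by blast
      obtain Y where Y: "Y \<in> star y U" "Y \<noteq> X" using second_line[OF U y] by blast
      have "\<phi> X \<noteq> \<phi> Y" using inj_onD[OF inj] X Y star_sub by blast
      moreover have "f y \<in> \<phi> X \<inter> \<phi> Y" using f_mem X Y y by (auto simp: star_def)
      moreover have "x \<in> \<phi> X \<inter> \<phi> Y" "is_line (\<phi> X)" "is_line (\<phi> Y)"
        using center(2) X Y star_sub by (auto simp: star_def)
      ultimately show ?thesis using lines_meet_in_point center(1) by blast
    qed
    have "span {f v} = span {x}" using span_singleton_eq[OF fx[OF v] f(1)[OF v(2)]] .
    then show ?thesis using fx[OF w] by simp
  next
    case plane
    have in_star: "\<phi> X \<in> star (f v) U'" if "X \<in> lines_in U" "f v \<in> \<phi> X" for X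
      using plane(3) that by (auto simp: star_def lines_in_def)
    have im: "\<phi> ` star v U \<subseteq> star (f v) U'"
      using in_star f_mem v star_sub by (auto simp: star_def lines_in_def)
    have "f v \<in> U'" using second_line[OF U v] im by (auto simp: star_def)
    \<comment> \<open>Both pencils have \<open>q + 1\<close> lines, so the inclusion
      \<open>im\<close> becomes an equality.\<close>
    then have "card (star (f v) U') = card (\<phi> ` star v U)"
      using card_star_plane[OF plane(1,2) _ f(1)[OF v(2)]] card_star_plane[OF U v]
        card_image[OF inj_on_subset[OF inj star_sub]] by simp
    then have eq: "\<phi> ` star v U = star (f v) U'"
      using im by (intro card_subset_eq) auto
    \<comment> \<open>Any line through \<open>u\<close> other than its join with \<open>v\<close>
      misses \<open>v\<close>, yet its image passes through \<open>f u\<close>, the same point as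
      \<open>f v\<close>.\<close>
    obtain X where X: "X \<in> star u U" "X \<noteq> span {u, v}"
      using second_line[OF U u(1) u0] by blast
    have "v \<notin> X" using X line_eq_span[of X u v] v u by (auto simp: star_def)
    have "f u \<in> \<phi> X" "is_line (\<phi> X)" using f_mem[of X u] line_map X u0 by (auto simp: star_def)
    moreover have "f v \<in> span {f u}"
      using span_singleton_eq[OF fuv f(1)[OF u0]] by (simp add: span_base)
    ultimately have "f v \<in> \<phi> X" using line_span_singleton_subset by blast
    then have "\<phi> X \<in> star (f v) U'" using in_star X star_sub by blast
    then obtain Y where Y: "Y \<in> star v U" "\<phi> X = \<phi> Y" using eq by (metis imageE)
    then have "X = Y" using inj_onD[OF inj] X star_sub by blast
    then show ?thesis using \<open>v \<notin> X\<close> Y by (simp add: star_def)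
  qed
qed

text \<open>Every point \<open>w\<close> lies in some plane containing \<open>u\<close> and
  \<open>v\<close>, where the planar result applies.\<close>

lemma collapse_global:
  assumes u: "u \<notin> span {v}" and v: "v \<noteq> 0" and fuv: "f u \<in> span {f v}" and w: "w \<noteq> 0"
  shows "f w \<in> span {f v}"
proof -
  have d2: "dim {u, v} = 2" using u v by (simp add: dim_insert)
  have "dim (span {u, v}) \<noteq> dim (UNIV :: 'b set)"
    unfolding dim_span d2 using dim_ge_5 by linarith
  then obtain z where z: "z \<notin> span {u, v}" by (metis UNIV_eq_I)
  \<comment> \<open>\<open>w\<close> itself completes the plane unless it is on the line of
    \<open>u\<close> and \<open>v\<close>; then any outside vector \<open>z\<close> does.\<close>
  define t where "t = (if w \<in> span {u, v} then z else w)"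
  have t: "t \<notin> span {u, v}" using z by (simp add: t_def)
  let ?U = "span {t, u, v}"
  have "dim ?U = 3" using dim_span_insert[OF t] d2 by simp
  moreover have "w \<in> ?U"
    using span_mono[of "{u, v}" "{t, u, v}"] by (cases "w \<in> span {u, v}") (auto simp: t_def span_base)
  moreover have "u \<in> ?U" "v \<in> ?U" by (auto simp: span_base)
  ultimately show ?thesis using collapse_plane[OF subspace_span, of "{t, u, v}" u v w] assms by blast
qed

section \<open>Excluding line spreads, and injectivity\<close>

text \<open>A spread partitions the nonzero vectors into blocks of size \<open>q ^ 2 - 1\<close>.
  For odd \<open>n\<close>, \<open>q ^ n\<close> is congruent to \<open>q\<close> modulo
  \<open>q ^ 2 - 1\<close>, so \<open>q ^ 2 - 1\<close> would divide the smaller positive number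
  \<open>q - 1\<close>.\<close>

lemma spread_impossible:
  assumes lines: "\<And>X. X \<in> F \<Longrightarrow> is_line X"
    and spread: "\<And>w. w \<noteq> 0 \<Longrightarrow> \<exists>!X. X \<in> F \<and> w \<in> X"
  shows False
proof -
  let ?n = "dim (UNIV :: 'b set)"
  have zero: "0 \<in> X" if "X \<in> F" for X using lines[OF that] by (simp add: is_line_def subspace_0)
  have eq: "UNIV - {0} = (\<Union>X\<in>F. X - {0})" using ex1_implies_ex[OF spread] by blast
  have "card (\<Union>X\<in>F. X - {0}) = (\<Sum>X\<in>F. card (X - {0}))"
    using spread by (intro card_UN_disjoint) auto
  also have "\<dots> = (\<Sum>X\<in>F. q ^ 2 - 1)"
    using lines zero card_subspace(2) by (intro sum.cong) (auto simp: is_line_def card_Diff_subset)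
  finally have "q ^ ?n - 1 = card F * (q ^ 2 - 1)"
    unfolding eq[symmetric] using card_subspace(2)[OF subspace_UNIV] by (simp add: card_Diff_subset)
  \<comment> \<open>Passing to integers turns truncated subtraction into true subtraction before the
    divisibility argument.\<close>
  then have "int (q ^ ?n - 1) = int (card F) * int (q ^ 2 - 1)"
    by (metis of_nat_mult)
  then have "(int q ^ ?n - 1) = int (card F) * (int q ^ 2 - 1)"
    using q_ge_2 by (simp add: of_nat_diff)
  then have dvd: "int q ^ 2 - 1 dvd int q ^ ?n - 1" by simp
  obtain m where m: "?n = 2 * m + 1" using odd_dim by (elim oddE)
  have "int q ^ 2 - 1 dvd (int q ^ 2) ^ m - 1"
    by (metis dvd_triv_left power_diff_1_eq)
  then have "int q ^ 2 - 1 dvd int q * ((int q ^ 2) ^ m - 1)" by (rule dvd_mult)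
  also have "int q * ((int q ^ 2) ^ m - 1) = (int q ^ ?n - 1) - (int q - 1)"
    unfolding m by (simp add: power_mult[symmetric] algebra_simps)
  finally have "int q ^ 2 - 1 dvd int q - 1"
    using dvd_diff[OF dvd] by fastforce
  then have "int q ^ 2 - 1 \<le> int q - 1" using q_ge_2 by (intro zdvd_imp_le) auto
  moreover have "int q ^ 1 < int q ^ 2" using q_ge_2 by (intro power_strict_increasing) auto
  ultimately show False unfolding power_one_right by linarith
qed

text \<open>Otherwise every star maps bijectively onto one star. The fibre over a line
  \<open>M\<close> of that star then has exactly one line through each point: a spread.\<close>

lemma f_injective:
  assumes "u \<notin> span {v}" "v \<noteq> 0"
  shows "f u \<notin> span {f v}"
proof
  assume fuv: "f u \<in> span {f v}"
  let ?c = "f v"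
  have same: "span {f w} = span {?c}" if "w \<noteq> 0" for w
    using collapse_global[OF assms fuv that] f(1)[OF that] by (rule span_singleton_eq)
  have stars: "\<phi> ` lines_through w = lines_through ?c" if "w \<noteq> 0" for w
  proof -
    \<comment> \<open>The representatives \<open>f w\<close> and \<open>?c\<close> may differ by a
      scalar, but a star depends only on the span.\<close>
    have "f w \<in> X \<longleftrightarrow> ?c \<in> X" if "is_line X" for X
      using line_span_singleton_subset[OF that] same[OF \<open>w \<noteq> 0\<close>]
        span_base[of "f w" "{f w}"] span_base[of ?c "{?c}"] by auto
    then show ?thesis using f(2)[OF that] by (auto simp: star_def)
  qed
  \<comment> \<open>Any line of the target star would do; the image of the line joining
    \<open>u\<close> and \<open>v\<close> is one at hand.\<close>
  define M where "M = \<phi> (span {u, v})"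
  have M: "M \<in> lines_through ?c"
    using line_map[OF is_line_span[OF assms(2,1)]] f_mem[OF is_line_span[OF assms(2,1)], of v] assms
    by (simp add: M_def star_def span_base)
  show False
  proof (rule spread_impossible)
    fix w :: 'b assume w: "w \<noteq> 0"
    have "M \<in> \<phi> ` lines_through w" using stars[OF w] M by simp
    then show "\<exists>!X. X \<in> {X. is_line X \<and> \<phi> X = M} \<and> w \<in> X"
      using inj_onD[OF inj_on_clique[OF is_clique_star[OF w]], of _ _ UNIV]
      by (auto simp: star_def)
  qed simp
qed

text \<open>Distinct lines with equal image are disjoint. A line joining a point of each is adjacent
  to \<open>X\<close>, so its image differs from \<open>\<phi> X\<close>; but both images contain
  \<open>f x\<close> and \<open>f y\<close>, against injectivity of \<open>f\<close>.\<close>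

lemma inj_on_lines: "inj_on \<phi> {X. is_line X}"
proof (rule inj_onI, rule ccontr)
  fix X Y assume "X \<in> {X. is_line X}" "Y \<in> {X. is_line X}" and eq: "\<phi> X = \<phi> Y" and "X \<noteq> Y"
  then have X: "is_line X" and Y: "is_line Y" by auto
  have "\<not> adjacent X Y" using adjacent_map[of X Y] eq by (auto simp: adjacent_iff)
  then have disj: "z = 0" if "z \<in> X" "z \<in> Y" for z
    using X Y \<open>X \<noteq> Y\<close> that by (auto simp: adjacent_iff)
  obtain x y where x: "x \<in> X" "x \<noteq> 0" and y: "y \<in> Y" "y \<noteq> 0"
    using line_has_nonzero X Y by metis
  have yx: "y \<notin> span {x}" using line_span_singleton_subset[OF X x(1)] disj y by blast
  let ?Z = "span {y, x}"
  have Z: "is_line ?Z" "x \<in> ?Z" "y \<in> ?Z"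
    using is_line_span[OF x(2) yx] by (auto simp: span_base)
  have "?Z \<noteq> X" using Z disj y by blast
  then have "adjacent ?Z X" using X Z x by (auto simp: adjacent_iff)
  then have "\<phi> ?Z \<noteq> \<phi> X" using adjacent_map by (auto simp: adjacent_iff)
  moreover have "f y \<in> \<phi> ?Z \<inter> \<phi> X" "f x \<in> \<phi> ?Z \<inter> \<phi> X"
    using f_mem[OF Z(1)] f_mem[OF X x] f_mem[OF Y y] Z x y eq by auto
  ultimately have "f y \<in> span {f x}"
    using lines_meet_in_point[OF line_map[OF Z(1)] line_map[OF X]] f(1)[OF x(2)] by blast
  then show False using f_injective[OF yx x(2)] by blast
qed

end

section \<open>Finite graphs and the conclusion\<close>

text \<open>Finiteness is used twice: on vertices it gives bijectivity, and on arcs it makes the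
  induced injection surjective, so adjacency is also reflected.\<close>

lemma injective_endomorphism_is_automorphism:
  assumes fin: "finite (pverts G)" and arcs: "parcs G \<subseteq> pverts G \<times> pverts G"
    and endo: "graph_endomorphism G \<phi>" and inj: "inj_on \<phi> (pverts G)"
  shows "graph_automorphism G \<phi>"
proof -
  have maps: "\<phi> ` pverts G \<subseteq> pverts G" using endo by (auto simp: graph_endomorphism_def)
  have bij: "bij_betw \<phi> (pverts G) (pverts G)"
    using endo_inj_surj[OF fin maps inj] inj by (simp add: bij_betw_def)
  let ?\<psi> = "map_prod \<phi> \<phi>"
  have injp: "inj_on ?\<psi> (pverts G \<times> pverts G)" using inj by (intro map_prod_inj_on)
  have "?\<psi> ` parcs G \<subseteq> parcs G"
    using endo arcs by (auto simp: graph_endomorphism_def)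
  then have surj: "?\<psi> ` parcs G = parcs G"
    using finite_subset[OF arcs] fin inj_on_subset[OF injp arcs] by (intro endo_inj_surj) auto
  have "(x, y) \<in> parcs G" if "x \<in> pverts G" "y \<in> pverts G" "(\<phi> x, \<phi> y) \<in> parcs G" for x y
  proof -
    have "?\<psi> (x, y) \<in> ?\<psi> ` parcs G" using surj that(3) by simp
    then obtain e where "e \<in> parcs G" "?\<psi> e = ?\<psi> (x, y)" by (metis imageE)
    then show ?thesis using inj_onD[OF injp, of e "(x, y)"] arcs that by auto
  qed
  then show ?thesis using bij endo by (auto simp: graph_automorphism_def graph_endomorphism_def)
qed

theorem mainTheorem4:
  fixes scale :: "'a::field \<Rightarrow> 'b::ab_group_add \<Rightarrow> 'b"
    and q k :: nat
  assumes "primepow q" and "card (UNIV :: 'a set) = q"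
    and "k \<ge> 2"
    and "vector_space scale" and "vector_space.dim scale (UNIV :: 'b set) = 2 * k + 1"
  shows "is_core (grassmann_graph scale 2)"
  unfolding is_core_def
proof (intro allI impI)
  fix \<phi> assume endo: "graph_endomorphism (grassmann_graph scale 2) \<phi>"
  interpret V: vector_space scale by fact
  \<comment> \<open>An infinite set has \<open>card\<close> 0, whereas a prime power is
    positive.\<close>
  have "finite (UNIV :: 'a set)"
    using assms(1,2) primepow_gt_0_nat[of q] by (metis card.infinite less_irrefl)
  obtain B where B: "V.independent B" "UNIV \<subseteq> V.span B" "card B = V.dim UNIV"
    using V.basis_exists by metis
  interpret fs: finite_vector_space scale B q
  proof unfold_locales
    \<comment> \<open>Likewise, \<open>card B\<close> is the positive number
      \<open>2 * k + 1\<close>, so \<open>B\<close> is finite.\<close>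
    show "finite B" using B(3) assms(5) by (intro card_ge_0_finite) simp
  qed (use B assms(2) \<open>finite (UNIV :: 'a set)\<close> in auto)
  let ?G = "grassmann_graph scale 2"
  have verts: "pverts ?G = {X. fs.is_line X}"
    by (simp add: grassmann_graph_def Let_def fs.is_line_def)
  have arcs: "parcs ?G = {(X, Y). fs.adjacent X Y}"
    by (auto simp: grassmann_graph_def Let_def fs.is_line_def fs.adjacent_def)
  interpret line_graph_endomorphism scale B q \<phi>
  proof unfold_locales
    show "5 \<le> V.dim (UNIV :: 'b set)" "odd (V.dim (UNIV :: 'b set))" using assms(3,5) by simp_all
    show "fs.is_line (\<phi> X)" if "fs.is_line X" for X
      using endo that by (auto simp: graph_endomorphism_def verts)
    show "fs.adjacent (\<phi> X) (\<phi> Y)" if "fs.adjacent X Y" for X Y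
      using endo that by (auto simp: graph_endomorphism_def verts arcs fs.adjacent_def)
  qed
  show "graph_automorphism ?G \<phi>"
  proof (rule injective_endomorphism_is_automorphism[OF _ _ endo])
    show "parcs ?G \<subseteq> pverts ?G \<times> pverts ?G" by (auto simp: verts arcs fs.adjacent_def)
    show "inj_on \<phi> (pverts ?G)" using inj_on_lines by (simp add: verts)
  qed simp
qed

end
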